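(* Let $a<b$ be real numbers and let $f:[a,b]\to\mathbb{R}$ be a convex function on $[a,b]$. Then for any $x\in(a,b)$ we have $$\frac12\left[(b-x)^2 f'_+(x)-(x-a)^2 f'_-(x)\right]\le (x-a)f(a)+(b-x)f(b)-\int_a^b f(t)\,dt .$$ The constant $\frac12$ on the left-hand side is sharp in the sense that it cannot be replaced by a larger constant: if $C$ is a constant such that $C\left[(b-x)^2 f'_+(x)-(x-a)^2 f'_-(x)\right]\le (x-a)f(a)+(b-x)f(b)-\int_a^b f(t)\,dt$ for every convex $f:[a,b]\to\mathbb{R}$ and every $x\in(a,b)$, then $C\le\frac12$.
   Context: $f'_+(x)$ and $f'_-(x)$ denote the right and left derivatives of $f$ at $x$ (these exist and are finite at interior points for convex $f$). *)

theory Defs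
  imports "HOL-Analysis.Analysis"
begin

text \<open>One-sided derivatives as limits of difference quotients. \<open>Lim\<close> is unspecified if the limit
  does not exist; the two lemmas below show that this does not happen for a convex function at an
  interior point.\<close>

definition right_deriv :: "(real \<Rightarrow> real) \<Rightarrow> real \<Rightarrow> real"
  where "right_deriv f x = Lim (at_right x) (\<lambda>y. (f y - f x) / (y - x))"

definition left_deriv :: "(real \<Rightarrow> real) \<Rightarrow> real \<Rightarrow> real"
  where "left_deriv f x = Lim (at_left x) (\<lambda>y. (f y - f x) / (y - x))"

lemma has_right_deriv_convex:
  fixes f :: "real \<Rightarrow> real"
  assumes f: "convex_on {a..b} f" and x: "x \<in> {a<..<b}"
  shows "(f has_real_derivative right_deriv f x) (at_right x)"
proof -
  define q where "q = (\<lambda>y. (f y - f x) / (y - x))"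
  have mono: "q y \<le> q z" if "x < y" "y \<le> z" "z \<le> b" for y z
  proof (cases "y = z")
    case False
    then show ?thesis
      using convex_on_slope_le(1)[OF f, of x z y] that x unfolding q_def
      by (smt (verit) atLeastAtMost_iff greaterThanLessThan_iff minus_divide_divide)
  qed simp
  have low: "q a \<le> q y" if "x < y" "y \<le> b" for y
    using convex_on_slope_le[OF f, of a y x] that x unfolding q_def
    by (smt (verit) atLeastAtMost_iff greaterThanLessThan_iff minus_divide_divide)
  define L where "L = Inf (q ` {x<..b})"
  have bdd: "bdd_below (q ` {x<..b})" using low by (auto intro!: bdd_belowI2[where m = "q a"])
  have "(q \<longlongrightarrow> L) (at_right x)"
  proof (rule decreasing_tendsto)
    show "\<forall>\<^sub>F y in at_right x. L \<le> q y"
      unfolding eventually_at_right_field L_def using x bdd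
      by (intro exI[of _ b]) (auto intro!: cInf_lower)
    show "\<forall>\<^sub>F y in at_right x. q y < u" if u: "L < u" for u
    proof -
      obtain z where z: "x < z" "z \<le> b" "q z < u"
        using u x bdd cInf_less_iff[of "q ` {x<..b}" u] unfolding L_def by auto
      then show ?thesis
        unfolding eventually_at_right_field
        by (intro exI[of _ z]) (meson le_less_trans less_imp_le mono)
    qed
  qed
  then show ?thesis
    unfolding has_field_derivative_iff right_deriv_def q_def
    by (simp add: tendsto_Lim)
qed

lemma has_left_deriv_convex:
  fixes f :: "real \<Rightarrow> real"
  assumes f: "convex_on {a..b} f" and x: "x \<in> {a<..<b}"
  shows "(f has_real_derivative left_deriv f x) (at_left x)"
proof -
  define q where "q = (\<lambda>y. (f y - f x) / (y - x))"
  have mono: "q y \<le> q z" if "a \<le> y" "y \<le> z" "z < x" for y z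
  proof (cases "y = z")
    case False
    then show ?thesis
      using convex_on_slope_le(2)[OF f, of y x z] that x unfolding q_def
      by (smt (verit) atLeastAtMost_iff greaterThanLessThan_iff minus_divide_divide)
  qed simp
  have up: "q y \<le> q b" if "a \<le> y" "y < x" for y
    using convex_on_slope_le[OF f, of y b x] that x unfolding q_def
    by (smt (verit) atLeastAtMost_iff greaterThanLessThan_iff minus_divide_divide)
  define L where "L = Sup (q ` {a..<x})"
  have bdd: "bdd_above (q ` {a..<x})" using up by (auto intro!: bdd_aboveI2[where M = "q b"])
  have "(q \<longlongrightarrow> L) (at_left x)"
  proof (rule increasing_tendsto)
    show "\<forall>\<^sub>F y in at_left x. q y \<le> L"
      unfolding eventually_at_left_field L_def using x bdd
      by (intro exI[of _ a]) (auto intro!: cSup_upper)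
    show "\<forall>\<^sub>F y in at_left x. u < q y" if u: "u < L" for u
    proof -
      obtain z where z: "a \<le> z" "z < x" "u < q z"
        using u x bdd less_cSup_iff[of "q ` {a..<x}" u] unfolding L_def by auto
      then show ?thesis
        unfolding eventually_at_left_field
        by (intro exI[of _ z]) (meson less_le_trans less_imp_le mono)
    qed
  qed
  then show ?thesis
    unfolding has_field_derivative_iff left_deriv_def q_def
    by (simp add: tendsto_Lim)
qed

end

theory Submission
  imports Defs
begin

text \<open>By convexity, \<open>f\<close> lies below the line of slope \<open>f'\<^sub>-(x)\<close> through \<open>(a, f a)\<close> on \<open>[a, x]\<close> and
  below the line of slope \<open>f'\<^sub>+(x)\<close> through \<open>(b, f b)\<close> on \<open>[x, b]\<close>; integrating these bounds
  gives the inequality. For affine \<open>f\<close> both bounds are equalities, so \<open>f t = t\<close>, with an \<open>x\<close> that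
  is not the midpoint, shows that the constant is sharp.\<close>

text \<open>A convex function on a closed interval may jump at the endpoints, so continuity on
  \<open>{a..b}\<close> cannot be used. Instead \<open>f\<close> is bounded on the whole interval
  and continuous in the interior, and the endpoints form a null set.\<close>

lemma convex_on_Icc_integrable:
  fixes f :: "real \<Rightarrow> real"
  assumes f: "convex_on {a..b} f"
  shows "f integrable_on {a..b}"
proof (cases "a < b")
  case False
  then have "{a..b} = {} \<or> {a..b} = {a}" by auto
  then show ?thesis by (auto simp: integrable_on_insert_iff)
next
  case True
  define M where "M = max (f a) (f b)"
  \<comment> \<open>The lower bound comes from reflection in the midpoint:
    \<open>(a + b) / 2\<close> is the mean of \<open>t\<close> and \<open>a + b - t\<close>, and the
    value at the reflected point is at most \<open>M\<close>.\<close>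
  define m where "m = 2 * f ((a + b) / 2) - M"
  have up: "f t \<le> M" if "t \<in> {a..b}" for t
    unfolding M_def using convex_on_le_max[OF f that] .
  have low: "m \<le> f t" if t: "t \<in> {a..b}" for t
  proof -
    have mid: "t / 2 + (a + b - t) / 2 = (a + b) / 2"
      by (simp add: field_simps)
    have "f ((1 - 1/2) *\<^sub>R t + (1/2) *\<^sub>R (a + b - t))
        \<le> (1 - 1/2) * f t + 1/2 * f (a + b - t)"
      by (rule convex_onD[OF f]) (use t in auto)
    then have "f ((a + b) / 2) \<le> f t / 2 + f (a + b - t) / 2"
      by (simp add: mid)
    moreover have "f (a + b - t) \<le> M" using t by (intro up) auto
    ultimately show ?thesis unfolding m_def by linarith
  qed
  have "convex_on {a<..<b} f"
    by (rule convex_on_subset[OF f]) auto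
  then have "continuous_on {a<..<b} f"
    by (intro convex_on_continuous) auto
  then have meas: "f \<in> borel_measurable (lebesgue_on {a<..<b})"
    by (intro continuous_imp_measurable_on_sets_lebesgue) auto
  have "f integrable_on {a<..<b}"
  proof (rule measurable_bounded_by_integrable_imp_integrable[OF meas])
    show "(\<lambda>_. \<bar>M\<bar> + \<bar>m\<bar>) integrable_on {a<..<b}"
      by (simp add: integrable_on_open_interval_real integrable_const_ivl)
    show "norm (f t) \<le> \<bar>M\<bar> + \<bar>m\<bar>" if "t \<in> {a<..<b}" for t
      using up[of t] low[of t] that by auto
  qed auto
  then show ?thesis
    by (simp add: integrable_on_open_interval_real)
qed

lemma slope_commute:
  fixes f :: "real \<Rightarrow> real"
  shows "(f x - f y) / (x - y) = (f y - f x) / (y - x)"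
  by (metis minus_diff_eq minus_divide_divide)

text \<open>Difference quotients based at \<open>x\<close> increase with \<open>y\<close>, so their
  limit as \<open>y\<close> decreases to \<open>x\<close> cannot exceed the quotient at
  \<open>y = b\<close>.\<close>

lemma convex_on_right_deriv_le_slope:
  assumes f: "convex_on {a..b} f" and x: "x \<in> {a<..<b}"
  shows "right_deriv f x \<le> (f b - f x) / (b - x)"
proof (rule tendsto_upperbound)
  show "((\<lambda>y. (f y - f x) / (y - x)) \<longlongrightarrow> right_deriv f x) (at_right x)"
    using has_right_deriv_convex[OF f x] by (simp add: has_field_derivative_iff)
  show "\<forall>\<^sub>F y in at_right x. (f y - f x) / (y - x) \<le> (f b - f x) / (b - x)"
    unfolding eventually_at_right_field
  proof (intro exI[of _ b] conjI allI impI)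
    show "(f y - f x) / (y - x) \<le> (f b - f x) / (b - x)" if "x < y" "y < b" for y
      using convex_on_slope_le(1)[OF f, of x b y] x that
      by (simp add: slope_commute[of f x])
  qed (use x in auto)
qed simp

text \<open>The same monotonicity, now with \<open>y\<close> increasing to \<open>x\<close> from the
  starting value \<open>y = a\<close>.\<close>

lemma convex_on_left_deriv_ge_slope:
  assumes f: "convex_on {a..b} f" and x: "x \<in> {a<..<b}"
  shows "(f x - f a) / (x - a) \<le> left_deriv f x"
proof (rule tendsto_lowerbound)
  show "((\<lambda>y. (f y - f x) / (y - x)) \<longlongrightarrow> left_deriv f x) (at_left x)"
    using has_left_deriv_convex[OF f x] by (simp add: has_field_derivative_iff)
  show "\<forall>\<^sub>F y in at_left x. (f x - f a) / (x - a) \<le> (f y - f x) / (y - x)"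
    unfolding eventually_at_left_field
  proof (intro exI[of _ a] conjI allI impI)
    show "(f x - f a) / (x - a) \<le> (f y - f x) / (y - x)" if "a < y" "y < x" for y
      using convex_on_slope_le(2)[OF f, of a x y] x that
      by (simp add: slope_commute[of f a])
  qed (use x in auto)
qed simp

text \<open>The graph lies below its chord over \<open>{x..b}\<close>. Pivoting the chord about its
  right end to the smaller slope \<open>right_deriv f x\<close> only raises it to the left of
  \<open>b\<close>.\<close>

lemma convex_on_le_line_right:
  assumes f: "convex_on {a..b} f" and x: "x \<in> {a<..<b}" and t: "t \<in> {x..b}"
  shows "f t \<le> f b - right_deriv f x * (b - t)"
proof -
  have "convex_on {x..b} f" by (rule convex_on_subset[OF f]) (use x in auto)
  from convex_onD_Icc''[OF this t]
  have "f t \<le> f b - (f b - f x) / (b - x) * (b - t)"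
    using x by (simp add: field_simps)
  also have "\<dots> \<le> f b - right_deriv f x * (b - t)"
    using mult_right_mono[OF convex_on_right_deriv_le_slope[OF f x], of "b - t"] t by simp
  finally show ?thesis .
qed

text \<open>Here the chord over \<open>{a..x}\<close> pivots about its left end, and the larger
  slope \<open>left_deriv f x\<close> raises it to the right of \<open>a\<close>.\<close>

lemma convex_on_le_line_left:
  assumes f: "convex_on {a..b} f" and x: "x \<in> {a<..<b}" and t: "t \<in> {a..x}"
  shows "f t \<le> f a + left_deriv f x * (t - a)"
proof -
  have "convex_on {a..x} f" by (rule convex_on_subset[OF f]) (use x in auto)
  from convex_onD_Icc'[OF this t]
  have "f t \<le> f a + (f x - f a) / (x - a) * (t - a)"
    using x by (simp add: field_simps)
  also have "\<dots> \<le> f a + left_deriv f x * (t - a)"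
    using mult_right_mono[OF convex_on_left_deriv_ge_slope[OF f x], of "t - a"] t by simp
  finally show ?thesis .
qed

text \<open>The base point \<open>s\<close> is free so that one formula serves both bounding lines:
  \<open>s = a\<close> on \<open>{a..x}\<close> and \<open>s = b\<close> on \<open>{x..b}\<close>.
  In each case one of the two squares vanishes.\<close>

lemma has_integral_linear_function:
  fixes c d :: real
  assumes "p \<le> q"
  shows "((\<lambda>t. c + d * (t - s)) has_integral
           c * (q - p) + d * ((q - s)\<^sup>2 - (p - s)\<^sup>2) / 2) {p..q}"
proof -
  have "((\<lambda>t. c + d * (t - s)) has_integral
          (c * q + d * (q - s)\<^sup>2 / 2) - (c * p + d * (p - s)\<^sup>2 / 2)) {p..q}"
    using assms
    by (intro fundamental_theorem_of_calculus)
       (auto intro!: derivative_eq_intros simp flip: has_real_derivative_iff_has_vector_derivative)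
  then show ?thesis by (simp add: algebra_simps diff_divide_distrib)
qed

lemma convex_on_integral_le_one_sided_deriv:
  assumes f: "convex_on {a..b} f" and x: "x \<in> {a<..<b}"
  shows "integral {a..b} f \<le> (x - a) * f a + (b - x) * f b
           - 1/2 * ((b - x)\<^sup>2 * right_deriv f x - (x - a)\<^sup>2 * left_deriv f x)"
proof -
  have int: "f integrable_on {a..b}" by (rule convex_on_Icc_integrable[OF f])
  then have intl: "f integrable_on {a..x}" and intr: "f integrable_on {x..b}"
    using x by (auto intro: integrable_subinterval_real)
  have "integral {a..x} f \<le> f a * (x - a) + left_deriv f x * ((x - a)\<^sup>2 - (a - a)\<^sup>2) / 2"
    using x convex_on_le_line_left[OF f x]
    by (intro has_integral_le[OF integrable_integral[OF intl] has_integral_linear_function]) auto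
  moreover have "integral {x..b} f \<le> f b * (b - x) + right_deriv f x * ((b - b)\<^sup>2 - (x - b)\<^sup>2) / 2"
    using x convex_on_le_line_right[OF f x]
    by (intro has_integral_le[OF integrable_integral[OF intr] has_integral_linear_function])
       (auto simp: algebra_simps)
  moreover have "integral {a..b} f = integral {a..x} f + integral {x..b} f"
    using x int by (simp add: Henstock_Kurzweil_Integration.integral_combine)
  ultimately show ?thesis
    by (simp add: field_simps power2_commute[of x b])
qed

theorem theorem5:
  fixes a b :: real
  assumes "a < b"
  shows "(\<forall>(f::real \<Rightarrow> real) x. convex_on {a..b} f \<longrightarrow> x \<in> {a<..<b} \<longrightarrow>
            1/2 * ((b - x)^2 * right_deriv f x - (x - a)^2 * left_deriv f x)
              \<le> (x - a) * f a + (b - x) * f b - integral {a..b} f)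
       \<and> (\<forall>C::real.
            (\<forall>(f::real \<Rightarrow> real) x. convex_on {a..b} f \<longrightarrow> x \<in> {a<..<b} \<longrightarrow>
               C * ((b - x)^2 * right_deriv f x - (x - a)^2 * left_deriv f x)
                 \<le> (x - a) * f a + (b - x) * f b - integral {a..b} f)
            \<longrightarrow> C \<le> 1/2)"
proof (intro conjI allI impI)
  fix f x assume "convex_on {a..b} f" "x \<in> {a<..<b}"
  from convex_on_integral_le_one_sided_deriv[OF this]
  show "1/2 * ((b - x)^2 * right_deriv f x - (x - a)^2 * left_deriv f x)
          \<le> (x - a) * f a + (b - x) * f b - integral {a..b} f"
    by linarith
next
  fix C :: real
  assume C: "\<forall>(f::real \<Rightarrow> real) x. convex_on {a..b} f \<longrightarrow> x \<in> {a<..<b} \<longrightarrow>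
               C * ((b - x)^2 * right_deriv f x - (x - a)^2 * left_deriv f x)
                 \<le> (x - a) * f a + (b - x) * f b - integral {a..b} f"
  txt \<open>Any \<open>x\<close> to the left of the midpoint makes the factor of \<open>C\<close> positive.\<close>
  define x where "x = (3 * a + b) / 4"
  have x: "x \<in> {a<..<b}" using assms by (simp add: x_def)
  \<comment> \<open>The quotient is 1 except at \<open>y = x\<close>, where division by zero gives
    0; the limit ignores that point. A general \<open>S\<close> covers both one-sided
    filters.\<close>
  have quotient: "((\<lambda>y. (y - x) / (y - x)) \<longlongrightarrow> 1) (at x within S)" for S
    by (rule tendsto_eventually) (auto simp: eventually_at_filter)
  have deriv: "right_deriv (\<lambda>t. t) x = 1" "left_deriv (\<lambda>t. t) x = 1"
    unfolding right_deriv_def left_deriv_def by (intro tendsto_Lim quotient trivial_limit_at_right_real trivial_limit_at_left_real)+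
  have "convex_on {a..b} (\<lambda>t::real. t)" by (simp add: convex_on_ident)
  with C x have "C * ((b - x)\<^sup>2 - (x - a)\<^sup>2)
      \<le> (x - a) * a + (b - x) * b - integral {a..b} (\<lambda>t. t)"
    using deriv by fastforce
  also have "integral {a..b} (\<lambda>t. t) = (b\<^sup>2 - a\<^sup>2) / 2"
    using assms by (intro integral_unique ident_has_integral) simp
  \<comment> \<open>Both sides equal \<open>(b - a) * ((a + b) / 2 - x)\<close>.\<close>
  also have "(x - a) * a + (b - x) * b - (b\<^sup>2 - a\<^sup>2) / 2 = 1/2 * ((b - x)\<^sup>2 - (x - a)\<^sup>2)"
    by (simp add: field_simps power2_eq_square)
  finally have "C * ((b - x)\<^sup>2 - (x - a)\<^sup>2) \<le> 1/2 * ((b - x)\<^sup>2 - (x - a)\<^sup>2)" .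
  moreover have "(x - a)\<^sup>2 < (b - x)\<^sup>2"
    using assms by (intro power_strict_mono) (auto simp: x_def field_simps)
  ultimately show "C \<le> 1/2" by simp
qed

end
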